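(* Let $m\ge3$ and let $d$ be a positive integer with $d^2\equiv1\pmod{2^m-1}$ whose binary Hamming weight satisfies $wt(d)>1$. Let $\alpha_1,\alpha_2,\alpha_3\in\mathbb{F}_{2^m}^*$ be pairwise distinct with $\alpha_i^{d+1}=1$, let $\alpha_4=\alpha_1+\alpha_2+\alpha_3$ satisfy $\alpha_4^{d+1}=1$, and let $\pi_i(y)=\alpha_iy^d$ ($i=1,2,3,4$); assume moreover that $\pi_1,\dots,\pi_4$ have the property $(P_1)$. Let $\sigma$ be a permutation of $\{\alpha_1,\alpha_2,\alpha_3,\alpha_4\}$, $k$ a positive integer, $\beta_1=\sigma(\alpha_2)/\alpha_1^k$, $\beta_2=\sigma(\alpha_3)/\alpha_2^k$, $\beta_3=\sigma(\alpha_4)/\alpha_3^k$, $\beta_4=\sigma(\alpha_1)/\alpha_4^k$, $h_i(y)=Tr(\beta_iy^k)$ for $i=1,2,3$, $h_4(y)=Tr(\beta_4y^k)+1$, and $f_i(x,y)=Tr(x\pi_i(y))+h_i(y)$ for $x,y\in\mathbb{F}_{2^m}$. Then $f=f_1\|f_2\|f_3\|f_4$ is a bent function in $2m+2$ variables and $f\notin\mathcal{M}^\#$.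
   Context: $Tr$ is the absolute trace of $\mathbb{F}_{2^m}$; functions on $\mathbb{F}_{2^m}\times\mathbb{F}_{2^m}$ are identified with functions on $\mathbb{F}_2^{2m}$ via a basis. A mapping $\pi\colon\mathbb{F}_2^m\to\mathbb{F}_2^m$ has property $(P_1)$ if for all linearly independent $v,w$ and all $y$, $\pi(y)+\pi(y+v)+\pi(y+w)+\pi(y+v+w)\ne0$. A Boolean function $g$ on $\mathbb{F}_2^N$ ($N$ even) is bent if $\sum_z(-1)^{g(z)+a\cdot z}=\pm2^{N/2}$ for all $a$. The Maiorana–McFarland class $\mathcal{M}$ on $\mathbb{F}_2^{2k}$ consists of $(x,y)\mapsto x\cdot\pi(y)+h(y)$ with $\pi$ a permutation of $\mathbb{F}_2^k$ and $h$ arbitrary; $\mathcal{M}^\#$ is its closure under extended-affine equivalence ($g'=g\circ A+l$, $A$ affine permutation, $l$ affine). For $g_1,\dots,g_4$ on $\mathbb{F}_2^n$, $g_1\|g_2\|g_3\|g_4$ is the function $(z,z_{n+1},z_{n+2})\mapsto g_1(z)+z_{n+1}(g_1+g_3)(z)+z_{n+2}(g_1+g_2)(z)+z_{n+1}z_{n+2}(g_1+g_2+g_3+g_4)(z)$ on $\mathbb{F}_2^{n+2}$. *)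

theory Defs
  imports
    "HOL-Library.Z2"
    "HOL-Library.Cardinality"
    "HOL-Number_Theory.Residues"
    "Jordan_Normal_Form.Matrix"
begin

text \<open>
  The two-element field is the type \<^typ>\<open>bit\<close>, and the space of \<open>n\<close>-tuples over it is
  \<^term>\<open>carrier_vec n :: bit vec set\<close>. Functions on \<open>n\<close>-tuples are total functions on
  \<^typ>\<open>bit vec\<close>; only their values on \<^term>\<open>carrier_vec n\<close> are ever used.
  The field with \<open>2 ^ m\<close> elements is a type \<open>'a :: finite_field\<close> with \<open>CARD('a) = 2 ^ m\<close>.
\<close>

section \<open>Finite fields of characteristic 2 as binary vector spaces\<close>

definition F2_scale :: "bit \<Rightarrow> 'a::field \<Rightarrow> 'a" where
  "F2_scale c x = of_bit c * x"

lemma CHAR_2_of_card: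
  assumes "CARD('a::finite_field) = 2 ^ m"
  shows "CHAR('a) = 2"
  using CHAR_dvd_CARD[where 'a='a] prime_CHAR_semidom[where 'a='a]
    finite_imp_CHAR_pos[where 'a='a] assms
  by (metis finite primes_dvd_imp_eq prime_dvd_power two_is_prime_nat)

lemma two_eq_zero_of_card:
  assumes "CARD('a::finite_field) = 2 ^ m"
  shows "(2::'a) = 0"
  using of_nat_CHAR[where 'a='a] CHAR_2_of_card[OF assms] by simp

lemma vector_space_F2_scale:
  assumes "CARD('a::finite_field) = 2 ^ m"
  shows "vector_space (F2_scale :: bit \<Rightarrow> 'a \<Rightarrow> 'a)"
proof -
  have xx: "x + x = 0" for x :: 'a
    using two_eq_zero_of_card[OF assms] by (metis mult_2 mult_zero_left)
  show ?thesis
  proof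
    fix a b :: bit and x y :: 'a
    show "F2_scale a (x + y) = F2_scale a x + F2_scale a y"
      by (simp add: F2_scale_def algebra_simps)
    show "F2_scale (a + b) x = F2_scale a x + F2_scale b x"
      by (cases a; cases b) (simp_all add: F2_scale_def xx)
    show "F2_scale a (F2_scale b x) = F2_scale (a * b) x"
      by (cases a; cases b) (simp_all add: F2_scale_def)
    show "F2_scale 1 x = x"
      by (simp add: F2_scale_def)
  qed
qed

text \<open>
  \<open>b 0, \<dots>, b (m - 1)\<close> is an ordered basis. The qualifier distinguishes the locale \<open>module\<close>
  of \<^theory>\<open>HOL.Modules\<close> from the one in HOL-Algebra.
\<close>

definition F2_basis :: "nat \<Rightarrow> (nat \<Rightarrow> 'a::field) \<Rightarrow> bool" where
  "F2_basis m b \<longleftrightarrow>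
     inj_on b {..<m} \<and>
     \<not> Modules.module.dependent F2_scale (b ` {..<m}) \<and>
     Modules.module.span F2_scale (b ` {..<m}) = UNIV"

definition of_coords :: "nat \<Rightarrow> (nat \<Rightarrow> 'a::field) \<Rightarrow> bit vec \<Rightarrow> 'a" where
  "of_coords m b v = (\<Sum>i<m. F2_scale (v $ i) (b i))"

lemma bij_betw_of_coords:
  fixes b :: "nat \<Rightarrow> 'a::finite_field"
  assumes "CARD('a) = 2 ^ m" and "F2_basis m b"
  shows "bij_betw (of_coords m b) (carrier_vec m) UNIV"
proof -
  interpret F2: vector_space "F2_scale :: bit \<Rightarrow> 'a \<Rightarrow> 'a"
    by (rule vector_space_F2_scale[OF assms(1)])
  have inj: "inj_on b {..<m}" and ind: "\<not> F2.dependent (b ` {..<m})"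
    and sp: "F2.span (b ` {..<m}) = UNIV"
    using assms(2) by (auto simp: F2_basis_def)
  have coords: "of_coords m b (vec m (\<lambda>i. u (b i))) = (\<Sum>x\<in>b ` {..<m}. F2_scale (u x) x)" for u
    by (simp add: of_coords_def sum.reindex[OF inj])
  show ?thesis
    unfolding bij_betw_def
  proof
    show "inj_on (of_coords m b) (carrier_vec m)"
    proof (rule inj_onI)
      fix v w :: "bit vec"
      assume v: "v \<in> carrier_vec m" and w: "w \<in> carrier_vec m"
        and eq: "of_coords m b v = of_coords m b w"
      define u where "u = (\<lambda>x. v $ (inv_into {..<m} b x) - w $ (inv_into {..<m} b x))"
      have "(\<Sum>x\<in>b ` {..<m}. F2_scale (u x) x) = (\<Sum>i<m. F2_scale (v $ i - w $ i) (b i))"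
        by (simp add: sum.reindex[OF inj] u_def inv_into_f_f[OF inj] del: minus_bit_def)
      also have "\<dots> = of_coords m b v - of_coords m b w"
        by (simp add: of_coords_def F2.scale_left_diff_distrib sum_subtractf del: minus_bit_def)
      finally have 0: "(\<Sum>x\<in>b ` {..<m}. F2_scale (u x) x) = 0"
        using eq by simp
      have "u x = 0" if "x \<in> b ` {..<m}" for x
        using F2.independentD[OF ind _ subset_refl 0 that] by simp
      then have "v $ i - w $ i = 0" if "i < m" for i
        using that inv_into_f_f[OF inj, of i] unfolding u_def by fastforce
      then have "v $ i = w $ i" if "i < m" for i
        using that by (metis right_minus_eq)
      then show "v = w"
        using v w by (intro eq_vecI) auto
    qed
    show "of_coords m b ` carrier_vec m = UNIV"
    proof (rule UNIV_eq_I[symmetric])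
      fix x :: 'a
      have "x \<in> range (\<lambda>u. \<Sum>v\<in>b ` {..<m}. F2_scale (u v) v)"
        using sp F2.span_finite[of "b ` {..<m}"] by auto
      then obtain u where "x = (\<Sum>v\<in>b ` {..<m}. F2_scale (u v) v)" by auto
      then have "x = of_coords m b (vec m (\<lambda>i. u (b i)))"
        by (simp add: coords)
      then show "x \<in> of_coords m b ` carrier_vec m" by auto
    qed
  qed
qed

definition Tr :: "nat \<Rightarrow> 'a::field \<Rightarrow> bit" where
  "Tr m x = (if (\<Sum>i<m. x ^ (2 ^ i)) = 0 then 0 else 1)"

lemma of_bit_Tr:
  fixes x :: "'a::finite_field"
  assumes "CARD('a) = 2 ^ m"
  shows "of_bit (Tr m x) = (\<Sum>i<m. x ^ (2 ^ i))"
proof -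
  let ?t = "\<Sum>i<m. x ^ (2 ^ i)"
  have "?t ^ 2 = (\<Sum>i<m. x ^ (2 ^ Suc i))"
    using CHAR_2_of_card[OF assms]
    by (subst freshmans_dream_sum) (auto simp flip: power_mult simp: mult.commute)
  also have "\<dots> + x = ?t + x ^ (2 ^ m)"
    using sum.lessThan_Suc_shift[of "\<lambda>i. x ^ (2 ^ i)" m] sum.lessThan_Suc[of "\<lambda>i. x ^ (2 ^ i)" m]
    by (simp add: add.commute)
  also have "x ^ (2 ^ m) = x"
    using finite_field_power_card_eq_same[of x] assms by simp
  finally have "?t * (?t - 1) = 0"
    by (simp add: power2_eq_square algebra_simps)
  then have "?t = 0 \<or> ?t = 1"
    by simp
  then show ?thesis
    by (auto simp: Tr_def)
qed

text \<open>
  Linear independence and addition are intrinsic to the field as a binary vector space, so the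
  property does not depend on a choice of coordinates. The conjunct \<open>v \<noteq> w\<close> is needed because
  \<open>dependent\<close> is a predicate on sets rather than families.
\<close>

definition P1 :: "('a::field \<Rightarrow> 'a) \<Rightarrow> bool" where
  "P1 p \<longleftrightarrow>
     (\<forall>v w y. v \<noteq> w \<and> \<not> Modules.module.dependent F2_scale {v, w} \<longrightarrow>
        p y + p (y + v) + p (y + w) + p (y + v + w) \<noteq> 0)"

text \<open>A function of two field elements, read in coordinates as a function of \<open>2 * m\<close> bits.\<close>

definition in_coords ::
    "nat \<Rightarrow> (nat \<Rightarrow> 'a::field) \<Rightarrow> ('a \<Rightarrow> 'a \<Rightarrow> bit) \<Rightarrow> bit vec \<Rightarrow> bit" where
  "in_coords m b F z = F (of_coords m b (vec_first z m)) (of_coords m b (vec_last z m))"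

definition hamming_weight :: "nat \<Rightarrow> nat" where
  "hamming_weight d = card {i. Bit_Operations.bit d i}"


section \<open>Bent functions and the completed Maiorana--McFarland class\<close>

definition bent :: "nat \<Rightarrow> (bit vec \<Rightarrow> bit) \<Rightarrow> bool" where
  "bent N g \<longleftrightarrow> even N \<and>
     (\<forall>a\<in>carrier_vec N.
        (\<Sum>z\<in>carrier_vec N. (- 1) ^ of_bit (g z + a \<bullet> z)) \<in> {2 ^ (N div 2), - (2 ^ (N div 2)) :: int})"

definition affine_map :: "nat \<Rightarrow> (bit vec \<Rightarrow> bit vec) \<Rightarrow> bool" where
  "affine_map N A \<longleftrightarrow>
     (\<exists>M\<in>carrier_mat N N. \<exists>c\<in>carrier_vec N. \<forall>z\<in>carrier_vec N. A z = M *\<^sub>v z + c)"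

definition affine_permutation :: "nat \<Rightarrow> (bit vec \<Rightarrow> bit vec) \<Rightarrow> bool" where
  "affine_permutation N A \<longleftrightarrow> affine_map N A \<and> bij_betw A (carrier_vec N) (carrier_vec N)"

definition affine_function :: "nat \<Rightarrow> (bit vec \<Rightarrow> bit) \<Rightarrow> bool" where
  "affine_function N l \<longleftrightarrow>
     (\<exists>a\<in>carrier_vec N. \<exists>c. \<forall>z\<in>carrier_vec N. l z = a \<bullet> z + c)"

definition EA_equivalent :: "nat \<Rightarrow> (bit vec \<Rightarrow> bit) \<Rightarrow> (bit vec \<Rightarrow> bit) \<Rightarrow> bool" where
  "EA_equivalent N g g' \<longleftrightarrow>
     (\<exists>A l. affine_permutation N A \<and> affine_function N l \<and>
        (\<forall>z\<in>carrier_vec N. g' z = g (A z) + l z))"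

text \<open>Both classes are indexed by half the number of variables.\<close>

definition MM :: "nat \<Rightarrow> (bit vec \<Rightarrow> bit) set" where
  "MM k = {g. \<exists>p h. bij_betw p (carrier_vec k) (carrier_vec k) \<and>
     (\<forall>x\<in>carrier_vec k. \<forall>y\<in>carrier_vec k. g (x @\<^sub>v y) = x \<bullet> p y + h y)}"

definition MM_completed :: "nat \<Rightarrow> (bit vec \<Rightarrow> bit) set" where
  "MM_completed k = {g'. \<exists>g\<in>MM k. EA_equivalent (2 * k) g g'}"

definition concat4 ::
    "nat \<Rightarrow> (bit vec \<Rightarrow> bit) \<Rightarrow> (bit vec \<Rightarrow> bit) \<Rightarrow> (bit vec \<Rightarrow> bit) \<Rightarrow> (bit vec \<Rightarrow> bit) \<Rightarrow>
     bit vec \<Rightarrow> bit" where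
  "concat4 n g1 g2 g3 g4 v =
     (let z = vec_first v n; s = v $ n; t = v $ (n + 1)
      in g1 z + s * (g1 z + g3 z) + t * (g1 z + g2 z) + s * t * (g1 z + g2 z + g3 z + g4 z))"

end

theory Submission
  imports
    Defs
    "HOL-Library.Product_Plus"
    "HOL-Computational_Algebra.Polynomial"
    "Berlekamp_Zassenhaus.Berlekamp_Type_Based"
begin

text \<open>
  Each \<open>f\<^sub>i\<close> is a Maiorana--McFarland function for the involution \<open>\<pi>\<^sub>i\<close>, so its Walsh
  transform at \<open>(a, b)\<close> is \<open>2 ^ m\<close> times the sign of
  \<open>h\<^sub>i (\<pi>\<^sub>i a) + Tr (b \<pi>\<^sub>i a)\<close>. Over \<open>i\<close> these exponents add up to \<open>1\<close>, because
  the \<open>\<alpha>\<^sub>i\<close> and their images under \<open>\<sigma>\<close> add up to \<open>0\<close>; hence an odd number of the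
  four signs are negative, whatever signs the last two variables contribute, and the
  concatenation is bent.

  A function in the completed class has a subspace \<open>U\<close> of half the dimension on which all second
  derivatives vanish. Let \<open>W\<close> consist of the \<open>w\<close> with \<open>(w, 0, 0, 0) \<in> U\<close>; pairing such an
  element with any \<open>(v\<^sub>1, v\<^sub>2, s, t) \<in> U\<close> shows that \<open>W\<close> is orthogonal to all
  \<open>\<pi>\<^sub>1 y + \<pi>\<^sub>i (y + v\<^sub>2)\<close>, where \<open>i\<close> is the index selected by \<open>(s, t)\<close>.
  If some \<open>v\<^sub>2 \<noteq> 0\<close> occurs with \<open>s = t = 0\<close>, property \<open>P1\<close> makes \<open>W\<close> of codimension
  at most \<open>2\<close> and the derivative of \<open>\<pi>\<^sub>1\<close> two-to-one and nowhere zero, so there are too many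
  such values. Otherwise \<open>W\<close> has codimension at most \<open>1\<close>, some \<open>(s, t) \<noteq> (0, 0)\<close> occurs,
  and evaluating at \<open>y = 0\<close> and \<open>y = v\<^sub>2\<close> again gives too many values.
\<close>

section \<open>Bits and their signs\<close>

declare add_bit_eq_xor [simp del] mult_bit_eq_and [simp del]

lemma bit_add_self [simp]: "x + x = (0::bit)" "x + (x + y) = (y::bit)"
  by (cases x; cases y; simp)+

lemma UNIV_bit: "UNIV = {0, 1 :: bit}"
  using bit_not_one_iff by auto

lemma CARD_bit [simp]: "CARD(bit) = 2"
  by (simp add: UNIV_bit)

instance bit :: finite
  by standard (simp add: UNIV_bit)

lemma sum_bit: "(\<Sum>s\<in>UNIV. g s) = g 0 + g (1::bit)" for g :: "bit \<Rightarrow> 'b::comm_monoid_add"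
  by (simp add: UNIV_bit)

definition chi :: "bit \<Rightarrow> int" where
  "chi c = (- 1) ^ of_bit c"

lemma chi_simps [simp]: "chi 0 = 1" "chi 1 = - 1"
  by (simp_all add: chi_def)

lemma chi_add: "chi (x + y) = chi x * chi y"
  by (cases x; cases y; simp)

text \<open>An odd number of the bits is 1, so three of the signs agree and the fourth is
  opposite.\<close>

lemma sum_four_chi:
  assumes "w + x + y + z = 1"
  shows "chi w + chi x + chi y + chi z = 2 \<or> chi w + chi x + chi y + chi z = - 2"
  using assms by (cases w; cases x; cases y; cases z) simp_all

section \<open>Additive subgroups, fibre counting and character sums\<close>

definition add_subgroup :: "'g::ab_group_add set \<Rightarrow> bool" where
  "add_subgroup U \<longleftrightarrow> 0 \<in> U \<and> (\<forall>x\<in>U. \<forall>y\<in>U. x - y \<in> U)"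

lemma add_subgroup_zero: "add_subgroup U \<Longrightarrow> 0 \<in> U"
  and add_subgroup_diff: "add_subgroup U \<Longrightarrow> x \<in> U \<Longrightarrow> y \<in> U \<Longrightarrow> x - y \<in> U"
  by (auto simp: add_subgroup_def)

lemma add_subgroup_add: "add_subgroup U \<Longrightarrow> x \<in> U \<Longrightarrow> y \<in> U \<Longrightarrow> x + y \<in> U"
  by (metis add_subgroup_def diff_0 diff_minus_eq_add)

lemma add_subgroup_UNIV: "add_subgroup UNIV"
  by (simp add: add_subgroup_def)

lemma add_subgroup_kernel:
  assumes U: "add_subgroup U" and g: "additive g"
  shows "add_subgroup {x \<in> U. g x = 0}"
  using add_subgroup_zero[OF U] add_subgroup_diff[OF U] additive.zero[OF g] additive.diff[OF g]
  by (simp add: add_subgroup_def)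

text \<open>Translating by one of its points embeds each fibre of \<open>g\<close> in the
  kernel.\<close>

lemma card_le_card_kernel_mult_card_image:
  fixes U :: "'g::ab_group_add set" and g :: "'g \<Rightarrow> 'h::ab_group_add"
  assumes "finite U" and U: "add_subgroup U" and g: "additive g"
  shows "card U \<le> card {x \<in> U. g x = 0} * card (g ` U)"
proof -
  interpret additive g by fact
  let ?K = "{x \<in> U. g x = 0}"
  have "card {x \<in> U. g x = c} \<le> card ?K" if "c \<in> g ` U" for c
  proof -
    from that obtain x0 where x0: "x0 \<in> U" "g x0 = c" by auto
    show ?thesis
      by (rule card_inj_on_le[of "\<lambda>x. x - x0"])
        (use \<open>finite U\<close> x0 in \<open>auto simp: diff inj_on_def add_subgroup_diff[OF U]\<close>)
  qed
  then have "(\<Sum>c\<in>g ` U. card {x \<in> U. g x = c}) \<le> (\<Sum>c\<in>g ` U. card ?K)"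
    by (intro sum_mono)
  moreover have "U = (\<Union>c\<in>g ` U. {x \<in> U. g x = c})" by auto
  ultimately show ?thesis
    using card_UN_le[of "g ` U" "\<lambda>c. {x \<in> U. g x = c}"] \<open>finite U\<close> by (simp add: mult.commute)
qed

text \<open>If \<open>l\<close> takes the value 1 at \<open>w0\<close>, translation by
  \<open>w0\<close> permutes \<open>W\<close> and flips every sign, so the sum is its own
  negative.\<close>

lemma sum_chi_additive:
  assumes "finite W" and W: "add_subgroup W" and l: "additive l"
  shows "(\<Sum>w\<in>W. chi (l w)) = (if \<forall>w\<in>W. l w = 0 then int (card W) else 0)"
proof (cases "\<forall>w\<in>W. l w = 0")
  case False
  then obtain w0 where w0: "w0 \<in> W" "l w0 = 1" by auto
  have "(\<Sum>w\<in>W. chi (l w)) = (\<Sum>w\<in>W. chi (l (w + w0)))"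
    by (rule sum.reindex_bij_witness[of _ "\<lambda>w. w + w0" "\<lambda>w. w - w0"])
      (use w0 in \<open>auto simp: add_subgroup_diff[OF W] add_subgroup_add[OF W]\<close>)
  also have "\<dots> = - (\<Sum>w\<in>W. chi (l w))"
    by (simp add: additive.add[OF l] w0 chi_add sum_negf)
  finally show ?thesis unfolding if_not_P[OF False] by simp
qed simp

section \<open>Characters of a binary field\<close>

locale binary_field =
  fixes m :: nat and ty :: "'a::finite_field itself"
  assumes card: "CARD('a) = 2 ^ m"
begin

lemma add_self [simp]: "x + x = (0::'a)" "x + (x + y) = (y :: 'a)"
  using two_eq_zero_of_card[OF card] by (metis mult_2 mult_zero_left, metis add.assoc add.left_neutral mult_2 mult_zero_left)

lemma minus_eq_add: "x - y = x + (y::'a)"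
  by (metis add_self(1) add_diff_cancel_right' diff_0 diff_minus_eq_add eq_neg_iff_add_eq_0)

lemma add_eq_0_iff': "x + y = 0 \<longleftrightarrow> x = (y::'a)"
  using minus_eq_add by (metis eq_iff_diff_eq_0)

lemma CHAR: "CHAR('a) = 2"
  by (rule CHAR_2_of_card[OF card])

lemma Tr_add: "Tr m (x + y :: 'a) = Tr m x + Tr m y"
proof -
  have "(x + y) ^ (2 ^ i) = x ^ (2 ^ i) + y ^ (2 ^ i)" for i
    by (rule freshmans_dream') (simp_all add: CHAR)
  then have "of_bit (Tr m (x + y)) = (of_bit (Tr m x) + of_bit (Tr m y) :: 'a)"
    by (simp only: of_bit_Tr[OF card] sum.distrib)
  then show ?thesis
    by (cases "Tr m (x + y)"; cases "Tr m x"; cases "Tr m y") simp_all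
qed

lemma Tr_0 [simp]: "Tr m (0::'a) = 0"
  using Tr_add[of 0 0] by simp

lemma additive_Tr: "additive (\<lambda>x::'a. Tr m (c * x))"
  by standard (simp add: Tr_add distrib_left)

lemma m_pos: "m > 0"
proof (rule ccontr)
  assume "\<not> m > 0"
  then have "CARD('a) = 1" using card by simp
  then show False
    using card_1_singletonE by (metis UNIV_I singletonD zero_neq_one)
qed

text \<open>The trace is a polynomial function of degree at most \<open>2 ^ (m - 1)\<close>, too
  small for \<open>2 ^ m\<close> roots; its coefficient at degree 1 shows that the polynomial is not
  zero.\<close>

lemma Tr_nonzero: "\<exists>x::'a. Tr m x = 1"
proof (rule ccontr)
  define p where "p = (\<Sum>i<m. Polynomial.monom (1::'a) (2 ^ i))"
  assume "\<not> ?thesis"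
  then have "poly p x = 0" for x
    using of_bit_Tr[OF card, of x] by (simp add: p_def poly_sum poly_monom)
  then have roots: "{x. poly p x = 0} = UNIV" by auto
  have "Polynomial.coeff p 1 = (\<Sum>i<m. if i = 0 then 1 else 0)"
    unfolding p_def Polynomial.coeff_sum by (intro sum.cong) auto
  then have "p \<noteq> 0" using m_pos by auto
  have "Polynomial.degree p \<le> 2 ^ (m - 1)"
    unfolding p_def
    by (intro degree_sum_le) (auto intro!: order.trans[OF degree_monom_le] power_increasing)
  moreover have "2 ^ m \<le> Polynomial.degree p"
    using card_poly_roots_bound[OF \<open>p \<noteq> 0\<close>] by (simp add: roots card)
  ultimately have "(2::nat) ^ m \<le> 2 ^ (m - 1)"
    by linarith
  then show False
    using m_pos by (simp add: power_increasing_iff)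
qed

lemma Tr_mult_nondegenerate:
  assumes "\<And>x::'a. Tr m (c * x) = 0"
  shows "c = 0"
proof (rule ccontr)
  assume "c \<noteq> 0"
  obtain x :: 'a where "Tr m x = 1" using Tr_nonzero by blast
  then show False using assms[of "x / c"] \<open>c \<noteq> 0\<close> by simp
qed

lemma sum_chi_Tr: "(\<Sum>x\<in>(UNIV::'a set). chi (Tr m (c * x))) = (if c = 0 then 2 ^ m else 0)"
  using Tr_mult_nondegenerate[of c]
  by (auto simp: sum_chi_additive[OF finite add_subgroup_UNIV additive_Tr] card)

text \<open>Duality by counting: summing the character over both arguments, only \<open>c = 0\<close> survives on
  one side, so the character sum of \<open>x \<mapsto> Tr (c x) + l x\<close> is nonzero for some \<open>c\<close>.\<close>

lemma additive_eq_Tr: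
  fixes l :: "'a \<Rightarrow> bit"
  assumes l: "additive l"
  obtains c where "\<And>x. l x = Tr m (c * x)"
proof -
  have "(\<Sum>c\<in>UNIV. \<Sum>x\<in>UNIV. chi (Tr m (c * x) + l x)) =
      (\<Sum>x\<in>UNIV. chi (l x) * (\<Sum>c\<in>UNIV. chi (Tr m (x * c))))"
    by (subst sum.swap) (simp add: chi_add sum_distrib_left mult.commute)
  also have "\<dots> = (\<Sum>x\<in>(UNIV::'a set). if x = 0 then 2 ^ m else 0)"
    unfolding sum_chi_Tr by (intro sum.cong) (auto simp: additive.zero[OF l])
  finally have "(\<Sum>c\<in>UNIV. \<Sum>x\<in>UNIV. chi (Tr m (c * x) + l x)) \<noteq> 0" by simp
  then obtain c where c: "(\<Sum>x\<in>UNIV. chi (Tr m (c * x) + l x)) \<noteq> 0"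
    by (meson sum.neutral)
  have "additive (\<lambda>x. Tr m (c * x) + l x)"
    by standard (simp add: Tr_add distrib_left additive.add[OF l] add_ac)
  from sum_chi_additive[OF finite add_subgroup_UNIV this] c
  have "Tr m (c * x) + l x = 0" for x
    by (auto split: if_splits)
  then have "l x = Tr m (c * x)" for x
    by (metis bit_add_self(2) add.right_neutral)
  then show ?thesis by (rule that)
qed

text \<open>Sum \<open>chi (Tr m (x * w))\<close> over all \<open>x\<close> and all \<open>w\<close>
  in \<open>W\<close>. Only \<open>w = 0\<close> survives, giving \<open>2 ^ m\<close>; every
  \<open>x\<close> contributes a nonnegative amount, and each one in \<open>S\<close> contributes
  \<open>card W\<close>. So \<open>S\<close> can be a bare set of derivative values.\<close>

lemma card_orthogonal_le:
  fixes W S :: "'a set"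
  assumes W: "add_subgroup W" and orth: "\<And>w s. w \<in> W \<Longrightarrow> s \<in> S \<Longrightarrow> Tr m (w * s) = 0"
  shows "card W * card S \<le> 2 ^ m"
proof -
  have inner: "(\<Sum>w\<in>W. chi (Tr m (x * w))) = (if \<forall>w\<in>W. Tr m (x * w) = 0 then int (card W) else 0)"
    for x by (rule sum_chi_additive[OF finite W additive_Tr])
  have "int (card W * card S) = (\<Sum>x\<in>S. \<Sum>w\<in>W. chi (Tr m (x * w)))"
    unfolding inner using orth
    by (subst sum.cong[OF refl if_P]) (auto, metis mult.commute)
  also have "\<dots> \<le> (\<Sum>x\<in>UNIV. \<Sum>w\<in>W. chi (Tr m (x * w)))"
    by (rule sum_mono2) (auto simp: inner)
  also have "\<dots> = (\<Sum>w\<in>W. if w = 0 then 2 ^ m else 0)"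
    by (subst sum.swap) (simp add: sum_chi_Tr mult.commute[of _ "_::'a"])
  also have "\<dots> \<le> 2 ^ m"
    by simp
  finally show ?thesis
    by (simp flip: of_nat_power of_nat_mult)
qed

text \<open>Summing over \<open>x\<close> first annihilates every \<open>y\<close> except the
  preimage \<open>y0\<close> of \<open>a\<close>.\<close>

lemma sum_chi_maiorana_mcfarland:
  fixes p :: "'a \<Rightarrow> 'a"
  assumes p: "\<And>y. p y = a \<longleftrightarrow> y = y0"
  shows "(\<Sum>x\<in>UNIV. \<Sum>y\<in>UNIV. chi (Tr m (x * p y) + q y + (Tr m (a * x) + r y)))
       = 2 ^ m * chi (q y0 + r y0)"
proof -
  have "(\<Sum>x\<in>UNIV. \<Sum>y\<in>UNIV. chi (Tr m (x * p y) + q y + (Tr m (a * x) + r y))) =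
    (\<Sum>y\<in>UNIV. chi (q y + r y) * (\<Sum>x\<in>UNIV. chi (Tr m ((p y + a) * x))))"
    by (subst sum.swap) (simp add: chi_add sum_distrib_left algebra_simps Tr_add)
  also have "\<dots> = (\<Sum>y\<in>UNIV. if y = y0 then 2 ^ m * chi (q y0 + r y0) else 0)"
    unfolding sum_chi_Tr by (intro sum.cong) (auto simp: add_eq_0_iff' p)
  finally show ?thesis by simp
qed

section \<open>Property \<open>P1\<close> against vanishing second derivatives\<close>

lemma P1_D:
  assumes "P1 p" "v \<noteq> 0" "w \<noteq> 0" "v \<noteq> (w::'a)"
  shows "p y + p (y + v) + p (y + w) + p (y + v + w) \<noteq> 0"
proof -
  interpret F2: vector_space "F2_scale :: bit \<Rightarrow> 'a \<Rightarrow> 'a"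
    by (rule vector_space_F2_scale[OF card])
  have "v \<notin> F2.span {w}"
  proof
    assume "v \<in> F2.span {w}"
    then obtain c where "v = F2_scale c w" by (auto simp: F2.span_singleton)
    then show False using assms by (cases c) (auto simp: F2_scale_def)
  qed
  then have "\<not> F2.dependent {v, w}"
    using assms by (auto simp: F2.independent_insert)
  then show ?thesis using assms by (auto simp: P1_def)
qed

text \<open>The ambient space has \<open>2 ^ (2 * m + 2)\<close> elements, so \<open>U\<close> has
  half its dimension. This size bounds \<open>card W\<close> from below and
  \<open>card_orthogonal_le\<close> bounds it from above; \<open>sep\<close> supplies the orthogonal
  values when the selector bits \<open>(s, t)\<close> are not both 0.\<close>

lemma no_vanishing_subgroup:
  fixes p :: "bit \<Rightarrow> bit \<Rightarrow> 'a \<Rightarrow> 'a" and q :: "bit \<Rightarrow> bit \<Rightarrow> 'a \<Rightarrow> bit"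
    and U :: "('a \<times> 'a \<times> bit \<times> bit) set"
  defines "G \<equiv> \<lambda>(x, y, s, t). Tr m (x * p s t y) + q s t y"
  assumes "m \<ge> 3" and P1: "P1 (p 0 0)" and inj: "inj (p 0 0)"
    and sep: "\<And>s t v. (s, t) \<noteq> (0, 0) \<Longrightarrow> 3 \<le> card (insert 0 (range (\<lambda>y. p 0 0 y + p s t (y + v))))"
    and U: "add_subgroup U" and card_U: "card U = 2 ^ (m + 1)"
    and vanish: "\<And>u v z. u \<in> U \<Longrightarrow> v \<in> U \<Longrightarrow> G z + G (z + u) + G (z + v) + G (z + u + v) = 0"
  shows False
proof -
  \<comment> \<open>\<open>V\<close> is the kernel of the selector bits on \<open>U\<close>, and a
    copy of \<open>W\<close> is the kernel of the second component on \<open>V\<close>; each image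
    bounds how much size is lost.\<close>
  define W where "W = {w. (w, 0, 0, 0) \<in> U}"
  define V where "V = {u \<in> U. (case u of (x, y, s, t) \<Rightarrow> (s, t)) = 0}"
  have W: "add_subgroup W"
    using add_subgroup_zero[OF U] add_subgroup_diff[OF U, of "(_, 0, 0, 0)" "(_, 0, 0, 0)"]
    by (auto simp: W_def add_subgroup_def zero_prod_def)
  have st: "additive (\<lambda>(x::'a, y::'a, s::bit, t::bit). (s, t))"
    by standard auto
  have V: "add_subgroup V"
    unfolding V_def by (rule add_subgroup_kernel[OF U st])
  have card_V: "card U \<le> card V * card ((\<lambda>(x, y, s, t). (s, t)) ` U)"
    unfolding V_def by (rule card_le_card_kernel_mult_card_image[OF finite U st])
  have kernel_V: "{u \<in> V. fst (snd u) = 0} = (\<lambda>w. (w, 0, 0, 0)) ` W"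
    by (auto simp: V_def W_def zero_prod_def)
  have "card V \<le> card {u \<in> V. fst (snd u) = 0} * card ((\<lambda>u. fst (snd u)) ` V)"
    by (rule card_le_card_kernel_mult_card_image[OF finite V]) (standard, auto)
  also have "card {u \<in> V. fst (snd u) = 0} = card W"
    unfolding kernel_V by (intro card_image) (auto simp: inj_on_def)
  finally have card_W: "card V \<le> card W * card ((\<lambda>u. fst (snd u)) ` V)" .
  have "card ((\<lambda>(x, y, s, t). (s, t)) ` U) \<le> CARD(bit \<times> bit)"
    by (rule card_mono) auto
  then have "card ((\<lambda>(x, y, s, t). (s, t)) ` U) \<le> 4"
    by simp
  then have "card U \<le> card V * 4"
    by (rule order.trans[OF card_V mult_le_mono2])
  then have V_ge: "2 ^ (m + 1) \<le> card V * 4" using card_U by simp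
  \<comment> \<open>In these two directions at \<open>(0, y, 0, 0)\<close> the values of
    \<open>q\<close> and the terms with \<open>v1\<close> occur twice and cancel.\<close>
  have orth: "Tr m (w * (p 0 0 y + p s t (y + v2))) = 0"
    if "w \<in> W" "(v1, v2, s, t) \<in> U" for w v1 v2 s t y
    using vanish[of "(w, 0, 0, 0)" "(v1, v2, s, t)" "(0, y, 0, 0)"] that
    by (simp add: W_def G_def Tr_add distrib_left distrib_right add_ac)
  \<comment> \<open>0 is orthogonal to everything, so it may be counted along with the
    values.\<close>
  have W_bound: "card W * card (insert 0 (range (\<lambda>y. p 0 0 y + p s t (y + v2)))) \<le> 2 ^ m"
    if "(v1, v2, s, t) \<in> U" for v1 v2 s t
    by (rule card_orthogonal_le[OF W]) (use orth that in auto)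
  have second_derivative: "p 0 0 y + p 0 0 (y + u2) + p 0 0 (y + v2) + p 0 0 (y + u2 + v2) = 0"
    if "(u1, u2, 0, 0) \<in> U" "(v1, v2, 0, 0) \<in> U" for u1 u2 v1 v2 y
  proof (rule Tr_mult_nondegenerate)
    fix x
    let ?D = "\<lambda>x. G (x, y, 0, 0) + G ((x, y, 0, 0) + (u1, u2, 0, 0)) + G ((x, y, 0, 0) + (v1, v2, 0, 0))
         + G ((x, y, 0, 0) + (u1, u2, 0, 0) + (v1, v2, 0, 0))"
    \<comment> \<open>Everything not involving \<open>x\<close> is common to both summands and
      cancels, leaving a trace linear in \<open>x\<close>.\<close>
    have "?D x + ?D 0 = 0"
      by (simp only: vanish[OF that]) simp
    then show "Tr m ((p 0 0 y + p 0 0 (y + u2) + p 0 0 (y + v2) + p 0 0 (y + u2 + v2)) * x) = 0"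
      by (simp add: G_def Tr_add distrib_left distrib_right add_ac mult.commute[of x])
  qed
  show False
  proof (cases "\<exists>v1 v2. v2 \<noteq> 0 \<and> (v1, v2, 0, 0) \<in> U")
    case True
    then obtain v1 v2 where v: "v2 \<noteq> 0" "(v1, v2, 0, 0) \<in> U" by blast
    \<comment> \<open>A second nonzero component different from \<open>v2\<close> would give a
      vanishing second derivative of \<open>p 0 0\<close>, against \<open>P1\<close>.\<close>
    have "(\<lambda>u. fst (snd u)) ` V \<subseteq> {0, v2}"
    proof (rule image_subsetI)
      fix u assume "u \<in> V"
      then have "(fst u, fst (snd u), 0, 0) \<in> U"
        by (cases u) (auto simp: V_def zero_prod_def)
      then show "fst (snd u) \<in> {0, v2}"
        using second_derivative[OF _ v(2)] P1_D[OF P1 _ v(1)] by blast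
    qed
    then have "card ((\<lambda>u. fst (snd u)) ` V) \<le> card {0, v2}"
      by (intro card_mono) auto
    then have "card V \<le> card W * 2"
      using v(1) by (intro order.trans[OF card_W mult_le_mono2]) simp
    then have W_ge: "2 ^ (m + 1) \<le> card W * 8" using V_ge by simp
    define D where "D = (\<lambda>y. p 0 0 y + p 0 0 (y + v2))"
    \<comment> \<open>\<open>D y + D y'\<close> is the second derivative of \<open>p 0 0\<close> at
      \<open>y\<close> in the directions \<open>v2\<close> and \<open>y + y'\<close>.\<close>
    have D_eq: "y' = y \<or> y' = y + v2" if "D y = D y'" for y y'
    proof (rule ccontr)
      assume neq: "\<not> (y' = y \<or> y' = y + v2)"
      then have "y + y' \<noteq> 0" "v2 \<noteq> y + y'"
        by (metis add_self add.right_neutral)+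
      from P1_D[OF P1 v(1) this, of y] have "D y + D y' \<noteq> 0"
        by (simp add: D_def add_ac)
      with that show False by simp
    qed
    have D_nz: "D y \<noteq> 0" for y
      using injD[OF inj, of y "y + v2"] v(1) by (auto simp: D_def add_eq_0_iff')
    have "card {y. D y = c} \<le> 2" if "c \<in> range D" for c
    proof -
      from that obtain y where y: "c = D y" by auto
      have "{y. D y = c} \<subseteq> {y, y + v2}" unfolding y by (auto dest: D_eq[OF sym])
      then have "card {y. D y = c} \<le> card {y, y + v2}" by (intro card_mono) auto
      also have "\<dots> \<le> 2" by (simp add: card_insert_if)
      finally show ?thesis .
    qed
    then have "(\<Sum>c\<in>range D. card {y. D y = c}) \<le> (\<Sum>c\<in>range D. 2)"
      by (intro sum_mono)
    moreover have "(UNIV :: 'a set) = (\<Union>c\<in>range D. {y. D y = c})" by auto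
    ultimately have "2 ^ m \<le> 2 * card (range D)"
      using card_UN_le[of "range D" "\<lambda>c. {y. D y = c}"] card by simp
    moreover have "card (insert 0 (range D)) = Suc (card (range D))"
      using D_nz by (intro card_insert_disjoint finite) (metis rangeE)
    \<comment> \<open>The summand 2 comes from the extra value 0. Without it the count would end in
      \<open>2 ^ m \<le> 8\<close>, which \<open>m = 3\<close> satisfies.\<close>
    ultimately have "2 ^ m + 2 \<le> 2 * card (insert 0 (range D))" by simp
    then have "2 ^ (m + 1) * (2 ^ m + 2) \<le> (card W * 8) * (2 * card (insert 0 (range D)))"
      by (intro mult_le_mono W_ge)
    also have "\<dots> \<le> 16 * 2 ^ m"
      using W_bound[OF v(2)] by (simp add: D_def)
    finally have "(2::nat) ^ m + 2 \<le> 8"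
      by simp
    moreover have "(2::nat) ^ 3 \<le> 2 ^ m"
      using \<open>m \<ge> 3\<close> by (intro power_increasing) auto
    ultimately show False by simp
  next
    case False
    then have "y = 0" if "(x, y, 0, 0) \<in> U" for x y
      using that by blast
    then have "(\<lambda>u. fst (snd u)) ` V \<subseteq> {0}"
      by (auto simp: V_def zero_prod_def)
    then have "card ((\<lambda>u. fst (snd u)) ` V) \<le> 1"
      using card_mono[of "{0::'a}" "(\<lambda>u. fst (snd u)) ` V"] by simp
    then have V_le: "card V \<le> card W"
      using order.trans[OF card_W mult_le_mono2] by fastforce
    have "card W \<le> 2 ^ m"
      using card_mono[of UNIV W] card by simp
    also have "(2::nat) ^ m < 2 ^ (m + 1)"
      by simp
    finally have "U \<noteq> V"
      using V_le card_U by auto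
    then obtain v where "v \<in> U" "(case v of (x, y, s, t) \<Rightarrow> (s, t)) \<noteq> 0"
      by (auto simp: V_def)
    then obtain v1 v2 s t where v: "(v1, v2, s, t) \<in> U" "(s, t) \<noteq> (0, 0)"
      by (cases v) (simp add: zero_prod_def)
    \<comment> \<open>Three orthogonal values leave \<open>W\<close> at most a third of the field,
      while \<open>V_ge\<close> and \<open>V_le\<close> give it at least half.\<close>
    have "card W * 3 \<le> 2 ^ m"
      using W_bound[OF v(1)] sep[OF v(2), of v2]
      by (auto intro: order.trans[OF mult_le_mono2])
    moreover have "2 ^ m \<le> card W * 2"
      using V_ge V_le by simp
    ultimately have "card W = 0" by linarith
    with \<open>2 ^ m \<le> card W * 2\<close> show False by simp
  qed
qed

end

section \<open>Second derivatives and the completed Maiorana--McFarland class\<close>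

text \<open>For fixed \<open>y\<close>, a Maiorana--McFarland function is affine in
  \<open>x\<close>, so its second derivatives vanish on the vectors with last half zero.
  \<open>U\<close> is the preimage of these under the linear part of \<open>A\<close>; the affine
  summand \<open>l\<close> has no second derivative.\<close>

lemma MM_completed_vanishing_subspace:
  assumes "f \<in> MM_completed k"
  obtains U where "U \<subseteq> carrier_vec (2 * k)" "card U = 2 ^ k" "0\<^sub>v (2 * k) \<in> U"
    "\<And>u v. u \<in> U \<Longrightarrow> v \<in> U \<Longrightarrow> u + v \<in> U"
    "\<And>u v z. u \<in> U \<Longrightarrow> v \<in> U \<Longrightarrow> z \<in> carrier_vec (2 * k) \<Longrightarrow>
       f z + f (z + u) + f (z + v) + f (z + u + v) = 0"
proof -
  let ?C = "carrier_vec (2 * k) :: bit vec set"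
  from assms obtain g A l where g: "g \<in> MM k" and A: "affine_permutation (2 * k) A"
    and l: "affine_function (2 * k) l" and f: "\<And>z. z \<in> ?C \<Longrightarrow> f z = g (A z) + l z"
    by (auto simp: MM_completed_def EA_equivalent_def)
  from g obtain p h where p: "bij_betw p (carrier_vec k) (carrier_vec k)"
    and g: "\<And>x y. x \<in> carrier_vec k \<Longrightarrow> y \<in> carrier_vec k \<Longrightarrow> g (x @\<^sub>v y) = x \<bullet> p y + h y"
    by (auto simp: MM_def)
  from A obtain M c where M: "M \<in> carrier_mat (2 * k) (2 * k)" and c: "c \<in> ?C"
    and A_eq: "\<And>z. z \<in> ?C \<Longrightarrow> A z = M *\<^sub>v z + c" and A_bij: "bij_betw A ?C ?C"
    by (auto simp: affine_permutation_def affine_map_def)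
  from l obtain a c' where a: "a \<in> ?C" and l: "\<And>z. z \<in> ?C \<Longrightarrow> l z = a \<bullet> z + c'"
    by (auto simp: affine_function_def)
  have M_in: "M *\<^sub>v z \<in> ?C" if "z \<in> ?C" for z
    using M that by simp
  \<comment> \<open>\<open>M\<close> and the bijection \<open>A\<close> differ only by the
    translation by \<open>c\<close>.\<close>
  have M_inj: "inj_on (\<lambda>v. M *\<^sub>v v) ?C"
    using A_bij A_eq unfolding bij_betw_def inj_on_def by metis
  have M_surj: "(\<lambda>v. M *\<^sub>v v) ` ?C = ?C"
    by (rule endo_inj_surj) (use M_inj M_in in auto)
  define X where "X = (\<lambda>x. x @\<^sub>v 0\<^sub>v k) ` (carrier_vec k :: bit vec set)"
  define U where "U = {v \<in> ?C. M *\<^sub>v v \<in> X}"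
  have X: "X \<subseteq> ?C"
    by (auto simp: X_def mult_2)
  have X_add: "x + y \<in> X" if "x \<in> X" "y \<in> X" for x y
    using that by (auto simp: X_def append_vec_add[of _ k _ _ k])
  show ?thesis
  proof (rule that)
    show "U \<subseteq> ?C" by (auto simp: U_def)
    have "card U = card ((\<lambda>v. M *\<^sub>v v) ` U)"
      by (rule card_image[symmetric], rule inj_on_subset[OF M_inj]) (auto simp: U_def)
    also have "(\<lambda>v. M *\<^sub>v v) ` U = X"
      using M_surj X by (auto simp: U_def)
    also have "card X = card (carrier_vec k :: bit vec set)"
      unfolding X_def by (rule card_image) (auto simp: inj_on_def append_vec_eq)
    finally show "card U = 2 ^ k"
      by (simp add: card_carrier_vec)
    have "M *\<^sub>v 0\<^sub>v (2 * k) = 0\<^sub>v k @\<^sub>v 0\<^sub>v k"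
      using M by (intro eq_vecI) (auto simp: scalar_prod_def)
    then show "0\<^sub>v (2 * k) \<in> U"
      by (auto simp: U_def X_def)
  next
    fix u v assume "u \<in> U" "v \<in> U"
    then show "u + v \<in> U"
      using X_add by (auto simp: U_def mult_add_distrib_mat_vec[OF M])
  next
    fix u v z assume u: "u \<in> U" and v: "v \<in> U" and z: "z \<in> ?C"
    then have uC: "u \<in> ?C" and vC: "v \<in> ?C" by (auto simp: U_def)
    from u obtain x1 where x1: "x1 \<in> carrier_vec k" "M *\<^sub>v u = x1 @\<^sub>v 0\<^sub>v k"
      by (auto simp: U_def X_def)
    from v obtain x2 where x2: "x2 \<in> carrier_vec k" "M *\<^sub>v v = x2 @\<^sub>v 0\<^sub>v k"
      by (auto simp: U_def X_def)
    define x y where "x = vec_first (A z) k" and "y = vec_last (A z) k"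
    have xy: "x \<in> carrier_vec k" "y \<in> carrier_vec k" by (auto simp: x_def y_def)
    have "A z \<in> carrier_vec (k + k)"
      using M_in[OF z] c A_eq[OF z] by (simp add: mult_2)
    then have Az: "A z = x @\<^sub>v y"
      by (simp add: x_def y_def)
    have step: "A (w + r) = A w + M *\<^sub>v r" if "w \<in> ?C" "r \<in> ?C" for w r
      using that c M_in by (simp add: A_eq mult_add_distrib_mat_vec[OF M] comm_add_vec[of c "2 * k"]
        assoc_add_vec[of _ "2 * k"])
    have Azu: "A (z + u) = (x + x1) @\<^sub>v y"
      using step[OF z uC] xy x1 by (simp add: Az append_vec_add[of _ k _ _ k])
    have Azv: "A (z + v) = (x + x2) @\<^sub>v y"
      using step[OF z vC] xy x2 by (simp add: Az append_vec_add[of _ k _ _ k])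
    have Azuv: "A (z + u + v) = (x + x1 + x2) @\<^sub>v y"
      using step[of "z + u" v] z uC vC xy x1 x2 by (simp add: Azu append_vec_add[of _ k _ _ k])
    have py: "p y \<in> carrier_vec k"
      using p xy by (auto dest: bij_betwE)
    have gsum: "g (A z) + g (A (z + u)) + g (A (z + v)) + g (A (z + u + v)) = 0"
      using xy x1 x2 py
      by (simp add: Az Azu Azv Azuv g add_scalar_prod_distrib[of _ k] add_ac)
    have lsum: "l z + l (z + u) + l (z + v) + l (z + u + v) = 0"
      using z uC vC a by (simp add: l scalar_prod_add_distrib[of _ "2 * k"] add_ac)
    have "f z + f (z + u) + f (z + v) + f (z + u + v) =
      (g (A z) + g (A (z + u)) + g (A (z + v)) + g (A (z + u + v))) +
      (l z + l (z + u) + l (z + v) + l (z + u + v))"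
      using z uC vC by (simp add: f add_ac)
    then show "f z + f (z + u) + f (z + v) + f (z + u + v) = 0"
      by (simp add: gsum lsum)
  qed
qed

section \<open>Transport between bit vectors and field coordinates\<close>

definition field_coords :: "nat \<Rightarrow> (nat \<Rightarrow> 'a::field) \<Rightarrow> bit vec \<Rightarrow> 'a \<times> 'a \<times> bit \<times> bit" where
  "field_coords m b v =
     (of_coords m b (vec_first (vec_first v (2 * m)) m),
      of_coords m b (vec_last (vec_first v (2 * m)) m), v $ (2 * m), v $ (2 * m + 1))"

text \<open>The bit \<open>t\<close> alone selects \<open>F2\<close> and \<open>s\<close> alone
  selects \<open>F3\<close>, because \<open>concat4\<close> pairs \<open>t\<close> with
  \<open>g1 + g2\<close> and \<open>s\<close> with \<open>g1 + g3\<close>.\<close>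

lemma concat4_in_coords:
  "concat4 (2 * m) (in_coords m b F1) (in_coords m b F2) (in_coords m b F3) (in_coords m b F4) v =
   (case field_coords m b v of (x, y, s, t) \<Rightarrow>
      (if s = 0 then if t = 0 then F1 else F2 else if t = 0 then F3 else F4) x y)"
  by (cases "v $ (2 * m)"; cases "v $ (2 * m + 1)")
    (simp_all add: concat4_def in_coords_def field_coords_def Let_def add_ac)

context binary_field
begin

lemma field_coords_add:
  fixes b :: "nat \<Rightarrow> 'a"
  assumes "v \<in> carrier_vec (2 * m + 2)" "w \<in> carrier_vec (2 * m + 2)"
  shows "field_coords m b (v + w) = field_coords m b v + field_coords m b w"
proof -
  interpret F2: vector_space "F2_scale :: bit \<Rightarrow> 'a \<Rightarrow> 'a"
    by (rule vector_space_F2_scale[OF card])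
  show ?thesis
    using assms
    by (simp add: field_coords_def of_coords_def vec_first_def vec_last_def F2.scale_left_distrib
      sum.distrib)
qed

lemma bij_betw_field_coords:
  fixes b :: "nat \<Rightarrow> 'a"
  assumes b: "F2_basis m b"
  shows "bij_betw (field_coords m b) (carrier_vec (2 * m + 2)) UNIV"
proof -
  have inj: "inj_on (field_coords m b) (carrier_vec (2 * m + 2))"
  proof (rule inj_onI)
    fix v w :: "bit vec"
    assume v: "v \<in> carrier_vec (2 * m + 2)" and w: "w \<in> carrier_vec (2 * m + 2)"
      and eq: "field_coords m b v = field_coords m b w"
    let ?v = "vec_first v (2 * m)" and ?w = "vec_first w (2 * m)"
    have of_coords_inj: "x = y" if "of_coords m b x = of_coords m b y" "x \<in> carrier_vec m"
      "y \<in> carrier_vec m" for x y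
      using bij_betw_of_coords[OF card b] that by (auto simp: bij_betw_def inj_on_def)
    have "vec_first ?v m = vec_first ?w m" "vec_last ?v m = vec_last ?w m"
      using eq by (auto simp: field_coords_def intro!: of_coords_inj)
    moreover have "vec_first x m @\<^sub>v vec_last x m = x" if "x \<in> carrier_vec (2 * m)"
      for x :: "bit vec"
      using that by (simp add: mult_2)
    ultimately have "?v = ?w"
      by (metis vec_first_carrier)
    then have "v $ i = w $ i" if "i < 2 * m" for i
      using that unfolding vec_first_def by (metis index_vec)
    moreover have "v $ (2 * m) = w $ (2 * m)" "v $ (2 * m + 1) = w $ (2 * m + 1)"
      using eq by (auto simp: field_coords_def)
    ultimately have "v $ i = w $ i" if "i < 2 * m + 2" for i
      using that by (metis Suc_eq_plus1 add_2_eq_Suc' less_SucE)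
    then show "v = w"
      using v w by (intro eq_vecI) auto
  qed
  have "field_coords m b ` carrier_vec (2 * m + 2) = UNIV"
    by (rule card_subset_eq)
      (simp_all only: card_image[OF inj] card_carrier_vec, auto simp: card power_add mult_2)
  with inj show ?thesis by (simp add: bij_betw_def)
qed

text \<open>\<open>r s t\<close> is the inverse of \<open>p s t\<close>, so it locates the surviving
  \<open>y\<close> in each Walsh sum; \<open>sum_r\<close> and \<open>sum_q\<close> make the four
  resulting exponents add up to 1.\<close>

lemma bent_in_field_coords:
  fixes b :: "nat \<Rightarrow> 'a" and p :: "bit \<Rightarrow> bit \<Rightarrow> 'a \<Rightarrow> 'a" and q :: "bit \<Rightarrow> bit \<Rightarrow> 'a \<Rightarrow> bit"
    and r :: "bit \<Rightarrow> bit \<Rightarrow> 'a \<Rightarrow> 'a"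
  assumes b: "F2_basis m b"
    and f: "\<And>v. f v = (case field_coords m b v of (x, y, s, t) \<Rightarrow> Tr m (x * p s t y) + q s t y)"
    and r: "\<And>s t y a. p s t y = a \<longleftrightarrow> y = r s t a"
    and sum_r: "\<And>a. r 0 0 a + r 0 1 a + r 1 0 a + r 1 1 a = 0"
    and sum_q: "\<And>a. q 0 0 (r 0 0 a) + q 0 1 (r 0 1 a) + q 1 0 (r 1 0 a) + q 1 1 (r 1 1 a) = 1"
  shows "bent (2 * m + 2) f"
  unfolding bent_def
proof (intro conjI ballI)
  fix a :: "bit vec" assume a: "a \<in> carrier_vec (2 * m + 2)"
  let ?C = "carrier_vec (2 * m + 2) :: bit vec set"
  define \<psi> where "\<psi> = inv_into ?C (field_coords m b)"
  note bij = bij_betw_field_coords[OF b]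
  have \<psi>: "\<psi> w \<in> ?C" "field_coords m b (\<psi> w) = w" for w
    using bij unfolding \<psi>_def bij_betw_def by (auto intro: inv_into_into f_inv_into_f)
  have \<psi>_coords: "\<psi> (field_coords m b v) = v" if "v \<in> ?C" for v
    using bij that unfolding \<psi>_def bij_betw_def by (auto intro: inv_into_f_f)
  have \<psi>_add: "\<psi> (v + w) = \<psi> v + \<psi> w" for v w
  proof -
    have "field_coords m b (\<psi> v + \<psi> w) = v + w"
      using \<psi> by (simp add: field_coords_add)
    then show ?thesis
      using \<psi>_coords[of "\<psi> v + \<psi> w"] \<psi>(1) by simp
  qed
  \<comment> \<open>The dot product need not be a trace form in the basis \<open>b\<close>; it is
    treated as an additive functional, and \<open>additive_eq_Tr\<close> yields its trace
    coefficients.\<close>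
  define l where "l = (\<lambda>w. a \<bullet> \<psi> w)"
  have l_add: "l (v + w) = l v + l w" for v w
    unfolding l_def \<psi>_add
    by (rule scalar_prod_add_distrib[OF a \<psi>(1) \<psi>(1)])
  have l_split: "l (x, y, s, t) = l (x, 0, 0, 0) + l (0, y, 0, 0) + l (0, 0, s, t)" for x y s t
    by (simp flip: l_add)
  have "additive (\<lambda>x. l (x, 0, 0, 0))"
    using l_add[of "(_, 0, 0, 0)" "(_, 0, 0, 0)"] by (simp add: additive_def)
  then obtain a1 where a1: "\<And>x. l (x, 0, 0, 0) = Tr m (a1 * x)"
    by (rule additive_eq_Tr) metis
  have "additive (\<lambda>y. l (0, y, 0, 0))"
    using l_add[of "(0, _, 0, 0)" "(0, _, 0, 0)"] by (simp add: additive_def)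
  then obtain a2 where a2: "\<And>y. l (0, y, 0, 0) = Tr m (a2 * y)"
    by (rule additive_eq_Tr) metis
  define c where "c s t = l (0, 0, s, t)" for s t
  define D where "D s t = q s t (r s t a1) + Tr m (a2 * r s t a1)" for s t
  have c: "c 0 0 = 0" "c 1 1 = c 1 0 + c 0 1"
    using l_add[of 0 0] l_add[of "(0, 0, 1, 0)" "(0, 0, 0, 1)"] by (simp_all add: c_def zero_prod_def)
  have "D 0 0 + D 0 1 + D 1 0 + D 1 1 =
      (q 0 0 (r 0 0 a1) + q 0 1 (r 0 1 a1) + q 1 0 (r 1 0 a1) + q 1 1 (r 1 1 a1)) +
      Tr m (a2 * (r 0 0 a1 + r 0 1 a1 + r 1 0 a1 + r 1 1 a1))"
    by (simp only: D_def Tr_add distrib_left add_ac)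
  then have D: "D 0 0 + D 0 1 + D 1 0 + D 1 1 = 1"
    by (simp add: sum_r sum_q)
  have walsh: "(\<Sum>x\<in>UNIV. \<Sum>y\<in>UNIV. chi (Tr m (x * p s t y) + q s t y + l (x, y, s, t)))
      = 2 ^ m * chi (D s t) * chi (c s t)" for s t
  proof -
    have "(\<Sum>x\<in>UNIV. \<Sum>y\<in>UNIV. chi (Tr m (x * p s t y) + q s t y + l (x, y, s, t)))
      = (\<Sum>x\<in>UNIV. \<Sum>y\<in>UNIV. chi (Tr m (x * p s t y) + q s t y + (Tr m (a1 * x) + Tr m (a2 * y)))) * chi (c s t)"
      unfolding sum_distrib_right
      by (intro sum.cong refl, subst l_split) (simp add: a1 a2 c_def chi_add)
    also have "\<dots> = 2 ^ m * chi (D s t) * chi (c s t)"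
      unfolding D_def by (subst sum_chi_maiorana_mcfarland[OF r]) simp
    finally show ?thesis .
  qed
  have "(\<Sum>z\<in>?C. (- 1) ^ of_bit (f z + a \<bullet> z)) =
      (\<Sum>w\<in>UNIV. chi ((case w of (x, y, s, t) \<Rightarrow> Tr m (x * p s t y) + q s t y) + l w))"
    unfolding sum.reindex_bij_betw[OF bij, symmetric]
    by (intro sum.cong) (simp_all add: chi_def f l_def \<psi>_coords)
  also have "\<dots> = (\<Sum>x\<in>UNIV. \<Sum>y\<in>UNIV. \<Sum>s\<in>UNIV. \<Sum>t\<in>UNIV.
      chi (Tr m (x * p s t y) + q s t y + l (x, y, s, t)))"
    by (simp add: sum.cartesian_product UNIV_Times_UNIV[symmetric] del: UNIV_Times_UNIV,
      intro sum.cong refl) auto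
  also have "\<dots> = 2 ^ m * (chi (D 0 0) * chi (c 0 0) + chi (D 0 1) * chi (c 0 1)
      + chi (D 1 0) * chi (c 1 0) + chi (D 1 1) * chi (c 1 1))"
    by (simp add: sum_bit sum.distrib walsh distrib_left mult_ac)
  also have "\<dots> = 2 ^ m * (chi (D 0 0 + c 0 0) + chi (D 0 1 + c 0 1)
      + chi (D 1 0 + c 1 0) + chi (D 1 1 + c 1 1))"
    by (simp only: chi_add)
  also have "\<dots> \<in> {2 ^ (m + 1), - (2 ^ (m + 1))}"
  proof -
    \<comment> \<open>The selector contributions \<open>c\<close> cancel by additivity, so the
      parity is that of the \<open>D\<close> terms.\<close>
    have "D 0 0 + c 0 0 + (D 0 1 + c 0 1) + (D 1 0 + c 1 0) + (D 1 1 + c 1 1) =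
        (D 0 0 + D 0 1 + D 1 0 + D 1 1) + (c 0 1 + c 1 0 + (c 1 0 + c 0 1))"
      by (simp only: c add_ac add_0_left)
    also have "\<dots> = 1"
      unfolding D by (simp add: add_ac)
    finally show ?thesis
      using sum_four_chi by fastforce
  qed
  finally show "(\<Sum>z\<in>?C. (- 1) ^ of_bit (f z + a \<bullet> z)) \<in>
      {2 ^ ((2 * m + 2) div 2), - (2 ^ ((2 * m + 2) div 2)) :: int}"
    by simp
qed simp

lemma not_MM_completed_in_field_coords:
  fixes b :: "nat \<Rightarrow> 'a" and p :: "bit \<Rightarrow> bit \<Rightarrow> 'a \<Rightarrow> 'a" and q :: "bit \<Rightarrow> bit \<Rightarrow> 'a \<Rightarrow> bit"
  assumes b: "F2_basis m b"
    and f: "\<And>v. f v = (case field_coords m b v of (x, y, s, t) \<Rightarrow> Tr m (x * p s t y) + q s t y)"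
    and "m \<ge> 3" "P1 (p 0 0)" "inj (p 0 0)"
    and sep: "\<And>s t v. (s, t) \<noteq> (0, 0) \<Longrightarrow> 3 \<le> card (insert 0 (range (\<lambda>y. p 0 0 y + p s t (y + v))))"
  shows "f \<notin> MM_completed (m + 1)"
proof
  assume "f \<in> MM_completed (m + 1)"
  then obtain U where U: "U \<subseteq> carrier_vec (2 * m + 2)" "card U = 2 ^ (m + 1)"
    "0\<^sub>v (2 * m + 2) \<in> U" "\<And>u v. u \<in> U \<Longrightarrow> v \<in> U \<Longrightarrow> u + v \<in> U"
    "\<And>u v z. u \<in> U \<Longrightarrow> v \<in> U \<Longrightarrow> z \<in> carrier_vec (2 * m + 2) \<Longrightarrow>
       f z + f (z + u) + f (z + v) + f (z + u + v) = 0"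
    by (rule MM_completed_vanishing_subspace) simp
  let ?\<phi> = "field_coords m b" and ?C = "carrier_vec (2 * m + 2) :: bit vec set"
  note bij = bij_betw_field_coords[OF b]
  have UC: "u \<in> ?C" if "u \<in> U" for u using U(1) that by auto
  \<comment> \<open>Characteristic 2 turns closure under sums into the closure under differences
    that \<open>add_subgroup\<close> asks for.\<close>
  have minus: "w - w' = w + w'" for w w' :: "'a \<times> 'a \<times> bit \<times> bit"
    by (cases w; cases w') (simp add: minus_eq_add)
  have "?\<phi> (0\<^sub>v (2 * m + 2)) = 0"
    using field_coords_add[of "0\<^sub>v (2 * m + 2)" "0\<^sub>v (2 * m + 2)" b] by simp
  then have "0 \<in> ?\<phi> ` U"
    using U(3) by force
  moreover have "w - w' \<in> ?\<phi> ` U" if "w \<in> ?\<phi> ` U" "w' \<in> ?\<phi> ` U" for w w'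
  proof -
    from that obtain u u' where "u \<in> U" "u' \<in> U" "w = ?\<phi> u" "w' = ?\<phi> u'" by auto
    then have "w - w' = ?\<phi> (u + u')" "u + u' \<in> U"
      using field_coords_add[of u u' b, OF UC UC] U(4) by (simp_all add: minus)
    then show ?thesis by auto
  qed
  ultimately have sub: "add_subgroup (?\<phi> ` U)"
    by (simp add: add_subgroup_def)
  have card_U: "card (?\<phi> ` U) = 2 ^ (m + 1)"
    using U(1,2) bij by (metis bij_betw_def card_image inj_on_subset)
  show False
  proof (rule no_vanishing_subgroup[of p, OF \<open>m \<ge> 3\<close> \<open>P1 (p 0 0)\<close> \<open>inj (p 0 0)\<close> sep sub card_U])
    let ?G = "\<lambda>(x, y, s, t). Tr m (x * p s t y) + q s t y"
    fix u v z assume "u \<in> ?\<phi> ` U" "v \<in> ?\<phi> ` U"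
    then obtain u' v' where uv: "u' \<in> U" "v' \<in> U" "u = ?\<phi> u'" "v = ?\<phi> v'" by auto
    have "z \<in> ?\<phi> ` ?C" using bij by (simp add: bij_betw_def)
    then obtain z' where z: "z' \<in> ?C" "z = ?\<phi> z'" by auto
    have G: "?G (?\<phi> w) = f w" for w by (simp add: f)
    show "?G z + ?G (z + u) + ?G (z + v) + ?G (z + u + v) = 0"
      using U(5)[OF uv(1,2) z(1)] uv(1,2) z(1) UC
      by (simp only: uv z field_coords_add[symmetric] G add_carrier_vec)
  qed
qed

end

section \<open>The four monomial permutations\<close>

theorem theorem7:
  fixes m d k :: nat
    and \<alpha> \<beta> :: "nat \<Rightarrow> 'a::finite_field"
    and \<pi> :: "nat \<Rightarrow> 'a \<Rightarrow> 'a"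
    and \<sigma> :: "'a \<Rightarrow> 'a"
    and h :: "nat \<Rightarrow> 'a \<Rightarrow> bit"
    and F :: "nat \<Rightarrow> 'a \<Rightarrow> 'a \<Rightarrow> bit"
    and b :: "nat \<Rightarrow> 'a"
    and f :: "bit vec \<Rightarrow> bit"
  assumes "CARD('a) = 2 ^ m" and "m \<ge> 3"
    and "d > 0" and "[d\<^sup>2 = 1] (mod 2 ^ m - 1)" and "hamming_weight d > 1"
    and "\<forall>i\<in>{1,2,3}. \<alpha> i \<noteq> 0 \<and> \<alpha> i ^ (d + 1) = 1" and "inj_on \<alpha> {1,2,3}"
    and "\<alpha> 4 = \<alpha> 1 + \<alpha> 2 + \<alpha> 3" and "\<alpha> 4 ^ (d + 1) = 1"
    and "\<forall>i\<in>{1,2,3,4}. \<forall>y. \<pi> i y = \<alpha> i * y ^ d"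
    and "\<forall>i\<in>{1,2,3,4}. P1 (\<pi> i)"
    and "bij_betw \<sigma> {\<alpha> 1, \<alpha> 2, \<alpha> 3, \<alpha> 4} {\<alpha> 1, \<alpha> 2, \<alpha> 3, \<alpha> 4}"
    and "k > 0"
    and "\<beta> 1 = \<sigma> (\<alpha> 2) / \<alpha> 1 ^ k" and "\<beta> 2 = \<sigma> (\<alpha> 3) / \<alpha> 2 ^ k"
    and "\<beta> 3 = \<sigma> (\<alpha> 4) / \<alpha> 3 ^ k" and "\<beta> 4 = \<sigma> (\<alpha> 1) / \<alpha> 4 ^ k"
    and "\<forall>i\<in>{1,2,3}. \<forall>y. h i y = Tr m (\<beta> i * y ^ k)"
    and "\<forall>y. h 4 y = Tr m (\<beta> 4 * y ^ k) + 1"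
    and "\<forall>i\<in>{1,2,3,4}. \<forall>x y. F i x y = Tr m (x * \<pi> i y) + h i y"
    and "F2_basis m b"
    and "f = concat4 (2 * m) (in_coords m b (F 1)) (in_coords m b (F 2))
                             (in_coords m b (F 3)) (in_coords m b (F 4))"
  shows "bent (2 * m + 2) f \<and> f \<notin> MM_completed (m + 1)"
proof -
  interpret binary_field m "TYPE('a)"
    by standard fact
  let ?I = "{1, 2, 3, 4 :: nat}"
  have \<alpha>_pow: "\<alpha> i ^ (d + 1) = 1" if "i \<in> ?I" for i
    using that assms(6,9) by auto
  then have \<alpha>_nz: "\<alpha> i \<noteq> 0" if "i \<in> ?I" for i
    using that by fastforce
  have dist: "\<alpha> 1 \<noteq> \<alpha> 2" "\<alpha> 1 \<noteq> \<alpha> 3" "\<alpha> 2 \<noteq> \<alpha> 3"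
    using assms(7) by (auto simp: inj_on_def)
  have "\<alpha> 1 + \<alpha> 4 = \<alpha> 2 + \<alpha> 3" "\<alpha> 2 + \<alpha> 4 = \<alpha> 1 + \<alpha> 3" "\<alpha> 3 + \<alpha> 4 = \<alpha> 1 + \<alpha> 2"
    unfolding assms(8) by (simp_all add: add_ac)
  \<comment> \<open>For instance \<open>\<alpha> 1 + \<alpha> 4 = \<alpha> 2 + \<alpha> 3\<close> is
    nonzero.\<close>
  then have dist4: "\<alpha> 1 \<noteq> \<alpha> 4" "\<alpha> 2 \<noteq> \<alpha> 4" "\<alpha> 3 \<noteq> \<alpha> 4"
    using dist add_eq_0_iff' by metis+
  have sum_\<alpha>: "\<alpha> 1 + \<alpha> 2 + \<alpha> 3 + \<alpha> 4 = 0"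
    unfolding assms(8) by simp
  \<comment> \<open>A permutation preserves the sum over the set, and distinctness turns both set
    sums into four-term sums.\<close>
  have "sum \<sigma> {\<alpha> 1, \<alpha> 2, \<alpha> 3, \<alpha> 4} = sum id {\<alpha> 1, \<alpha> 2, \<alpha> 3, \<alpha> 4}"
    using sum.reindex_bij_betw[OF assms(12), of id] by simp
  then have sum_\<sigma>: "\<sigma> (\<alpha> 1) + \<sigma> (\<alpha> 2) + \<sigma> (\<alpha> 3) + \<sigma> (\<alpha> 4) = 0"
    using dist dist4 sum_\<alpha> by (simp add: add_ac)
  \<comment> \<open>The exponent is \<open>d\<^sup>2\<close>, congruent to 1 modulo the order of the
    multiplicative group; 0 is fixed because \<open>d > 0\<close>.\<close>
  have pow_dd: "(y ^ d) ^ d = y" for y :: 'a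
  proof (cases "y = 0")
    case False
    obtain n where "d\<^sup>2 = n * (2 ^ m - 1) + 1"
      using cong_le_nat[of 1 "d\<^sup>2" "2 ^ m - 1"] assms(3,4)
      by (auto simp: cong_sym_eq algebra_simps)
    then have "(y ^ d) ^ d = (y ^ (2 ^ m - 1)) ^ n * y"
      by (simp add: power2_eq_square mult.commute[of n] flip: power_mult)
    moreover have "y ^ (2 ^ m - 1) * y = 1 * y"
      using finite_field_power_card_eq_same[of y] assms(1)
      by (metis mult_1 power_minus_mult zero_less_numeral zero_less_power)
    ultimately show ?thesis
      using False by simp
  qed (use assms(3) in simp)
  have involution: "\<pi> i (\<pi> i y) = y" if "i \<in> ?I" for i y
  proof -
    have "\<pi> i (\<pi> i y) = \<alpha> i ^ (d + 1) * (y ^ d) ^ d"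
      using that assms(10) by (auto simp: power_mult_distrib)
    then show ?thesis
      using \<alpha>_pow[OF that] pow_dd by simp
  qed
  \<comment> \<open>The denominator of \<open>\<beta> i\<close> cancels the factor
    \<open>\<alpha> i ^ k\<close> produced by \<open>\<pi> i\<close>, so the index survives only in
    \<open>c\<close> and \<open>e\<close>.\<close>
  have h_dual: "h i (\<pi> i a) = Tr m (c * (a ^ d) ^ k) + e"
    if "i \<in> ?I" "\<beta> i = c / \<alpha> i ^ k" "\<And>y. h i y = Tr m (\<beta> i * y ^ k) + e" for i a c e
    using that \<alpha>_nz[OF that(1)] assms(10) by (auto simp: power_mult_distrib)
  define j :: "bit \<Rightarrow> bit \<Rightarrow> nat" where
    "j s t = (if s = 0 then if t = 0 then 1 else 2 else if t = 0 then 3 else 4)" for s t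
  have j_simps: "j 0 0 = 1" "j 0 1 = 2" "j 1 0 = 3" "j 1 1 = 4" and j_in: "j s t \<in> ?I" for s t
    by (simp_all add: j_def)
  have f: "f v = (case field_coords m b v of (x, y, s, t) \<Rightarrow> Tr m (x * \<pi> (j s t) y) + h (j s t) y)" for v
    unfolding assms(22) concat4_in_coords using assms(20)
    by (auto simp: j_def split: prod.splits)
  show ?thesis
  proof
    show "bent (2 * m + 2) f"
    proof (rule bent_in_field_coords[OF assms(21) f, where r = "\<lambda>s t. \<pi> (j s t)"])
      show "\<pi> (j s t) y = a \<longleftrightarrow> y = \<pi> (j s t) a" for s t y a
        using involution[OF j_in] by metis
      show "\<pi> (j 0 0) a + \<pi> (j 0 1) a + \<pi> (j 1 0) a + \<pi> (j 1 1) a = 0" for a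
        using sum_\<alpha> assms(10) by (simp add: j_simps flip: distrib_right)
      show "h (j 0 0) (\<pi> (j 0 0) a) + h (j 0 1) (\<pi> (j 0 1) a) + h (j 1 0) (\<pi> (j 1 0) a)
        + h (j 1 1) (\<pi> (j 1 1) a) = 1" for a
      proof -
        have "h 1 (\<pi> 1 a) = Tr m (\<sigma> (\<alpha> 2) * (a ^ d) ^ k) + 0"
          by (rule h_dual) (use assms(14,18) in auto)
        moreover have "h 2 (\<pi> 2 a) = Tr m (\<sigma> (\<alpha> 3) * (a ^ d) ^ k) + 0"
          by (rule h_dual) (use assms(15,18) in auto)
        moreover have "h 3 (\<pi> 3 a) = Tr m (\<sigma> (\<alpha> 4) * (a ^ d) ^ k) + 0"
          by (rule h_dual) (use assms(16,18) in auto)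
        moreover have "h 4 (\<pi> 4 a) = Tr m (\<sigma> (\<alpha> 1) * (a ^ d) ^ k) + 1"
          by (rule h_dual) (use assms(17,19) in auto)
        ultimately have "h 1 (\<pi> 1 a) + h 2 (\<pi> 2 a) + h 3 (\<pi> 3 a) + h 4 (\<pi> 4 a) =
            Tr m ((\<sigma> (\<alpha> 1) + \<sigma> (\<alpha> 2) + \<sigma> (\<alpha> 3) + \<sigma> (\<alpha> 4)) * (a ^ d) ^ k) + 1"
          by (simp only: Tr_add distrib_right add_ac add_0_left)
        then show ?thesis
          unfolding sum_\<sigma> j_simps by simp
      qed
    qed
  next
    show "f \<notin> MM_completed (m + 1)"
    proof (rule not_MM_completed_in_field_coords[OF assms(21) f assms(2)])
      show "P1 (\<pi> (j 0 0))" using assms(11) by (simp add: j_simps)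
      show "inj (\<pi> (j 0 0))"
        using involution[OF j_in] by (metis injI)
      show "3 \<le> card (insert 0 (range (\<lambda>y. \<pi> (j 0 0) y + \<pi> (j s t) (y + v))))"
        if st: "(s, t) \<noteq> (0, 0)" for s t v
      proof -
        let ?S = "insert 0 (range (\<lambda>y. \<pi> (j 0 0) y + \<pi> (j s t) (y + v)))"
        have \<pi>: "\<pi> (j s t) y = \<alpha> (j s t) * y ^ d" for s t y
          using assms(10) j_in by blast
        have ne: "\<alpha> (j 0 0) \<noteq> \<alpha> (j s t)"
          using st dist dist4 by (auto simp: j_def)
        show ?thesis
        proof (cases "v = 0")
          case True
          \<comment> \<open>For \<open>v = 0\<close> the map is a nonzero multiple of the injective
            \<open>y ^ d\<close>, so it takes \<open>2 ^ m\<close> values.\<close>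
          have "inj (\<lambda>y. \<pi> (j 0 0) y + \<pi> (j s t) (y + v))"
          proof (rule injI)
            fix y y' assume "\<pi> (j 0 0) y + \<pi> (j s t) (y + v) = \<pi> (j 0 0) y' + \<pi> (j s t) (y' + v)"
            then have "(\<alpha> (j 0 0) + \<alpha> (j s t)) * y ^ d = (\<alpha> (j 0 0) + \<alpha> (j s t)) * y' ^ d"
              using True by (simp add: \<pi> distrib_right)
            then have "y ^ d = y' ^ d"
              using ne by (simp add: add_eq_0_iff')
            then show "y = y'" using pow_dd by metis
          qed
          then have "2 ^ m \<le> card ?S"
            using card_mono[of ?S "range (\<lambda>y. \<pi> (j 0 0) y + \<pi> (j s t) (y + v))"]
            by (simp add: card_image assms(1) subset_insertI)
          moreover have "(2::nat) ^ 3 \<le> 2 ^ m"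
            using assms(2) by (intro power_increasing) auto
          ultimately show ?thesis by simp
        next
          case False
          \<comment> \<open>At \<open>y = 0\<close> and at \<open>y = v\<close> one of the two
            summands vanishes; the values left are nonzero and distinct.\<close>
          have "\<alpha> (j s t) * v ^ d \<in> ?S"
            by (rule insertI2, rule range_eqI[of _ _ 0]) (use assms(3) in \<open>simp add: \<pi>\<close>)
          moreover have "\<alpha> (j 0 0) * v ^ d \<in> ?S"
            by (rule insertI2, rule range_eqI[of _ _ v]) (use assms(3) in \<open>simp add: \<pi>\<close>)
          ultimately have "card {0, \<alpha> (j s t) * v ^ d, \<alpha> (j 0 0) * v ^ d} \<le> card ?S"
            by (intro card_mono) auto
          moreover have "card {0, \<alpha> (j s t) * v ^ d, \<alpha> (j 0 0) * v ^ d} = 3"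
            using False ne \<alpha>_nz[OF j_in] by simp
          ultimately show ?thesis by simp
        qed
      qed
    qed
  qed
qed

end
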